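(* Let $C\subseteq\mathbb{R}^d$ be a polyhedral cone. The face lattice of the Moreau fan $\mathcal{M}(C)$ is isomorphic (as a partially ordered set) to the interval poset $I(\mathcal{F}(C))$.
   Context: Polyhedral cones are nonempty and contain the origin. The face lattice $\mathcal{F}(C)$ of a polyhedral cone $C$ is the collection of nonempty faces of $C$ (including $C$ itself), partially ordered by inclusion. For $F\in\mathcal{F}(C)$, the normal cone is $N_FC=\{c\in\mathbb{R}^d : \langle c,x\rangle\le\langle c,y\rangle \text{ for all } x\in C,\ y\in F\}$, and $\Pi_F(C)=F+N_FC$, a closed full-dimensional polyhedral cone (the closure of the set of points of $\mathbb{R}^d$ whose nearest point in $C$ lies in the relative interior of $F$). The Moreau fan of $C$ is $\mathcal{M}(C)=\{\Pi_F(C) : F \in \mathcal{F}(C)\}$, a complete fan given by its full-dimensional cones; its face lattice is the set of all nonempty faces of the cones $\Pi_F(C)$, $F\in\mathcal{F}(C)$, ordered by inclusion. For a partially ordered set $(\mathcal{P},\preceq)$, the interval poset $I(\mathcal{P})$ is the collection of nonempty intervals $[a,c]=\{b : a\preceq b\preceq c\}$ ordered by reverse inclusion. *)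

theory Defs
  imports "HOL-Analysis.Analysis"
begin

(* HOL-Analysis "cone" allows the empty set; "polyhedron" entails convexity.
   Together with nonemptiness these force 0 to lie in C. *)
definition polyhedral_cone :: "'a::euclidean_space set \<Rightarrow> bool" where
  "polyhedral_cone C \<longleftrightarrow> polyhedron C \<and> cone C \<and> C \<noteq> {}"

definition face_lattice :: "'a::real_vector set \<Rightarrow> 'a set set" where
  "face_lattice C = {F. F face_of C \<and> F \<noteq> {}}"

definition normal_cone :: "'a::real_inner set \<Rightarrow> 'a set \<Rightarrow> 'a set" where
  "normal_cone F C = {c. \<forall>x\<in>C. \<forall>y\<in>F. c \<bullet> x \<le> c \<bullet> y}"

definition moreau_cone :: "'a::real_inner set \<Rightarrow> 'a set \<Rightarrow> 'a set" where
  "moreau_cone F C = F + normal_cone F C"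

definition moreau_fan :: "'a::real_inner set \<Rightarrow> 'a set set" where
  "moreau_fan C = {moreau_cone F C | F. F \<in> face_lattice C}"

(* A fan is represented by its full-dimensional cones. *)
definition fan_face_lattice :: "'a::real_vector set set \<Rightarrow> 'a set set" where
  "fan_face_lattice M = (\<Union>P\<in>M. face_lattice P)"

(* Posets are given by a carrier and an order relation on it. *)
definition interval :: "'p set \<Rightarrow> ('p \<Rightarrow> 'p \<Rightarrow> bool) \<Rightarrow> 'p \<Rightarrow> 'p \<Rightarrow> 'p set" where
  "interval P le a c = {b \<in> P. le a b \<and> le b c}"

definition interval_poset :: "'p set \<Rightarrow> ('p \<Rightarrow> 'p \<Rightarrow> bool) \<Rightarrow> 'p set set" where
  "interval_poset P le = {interval P le a c | a c. a \<in> P \<and> c \<in> P \<and> interval P le a c \<noteq> {}}"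

definition poset_isomorphic ::
  "'p set \<Rightarrow> ('p \<Rightarrow> 'p \<Rightarrow> bool) \<Rightarrow> 'q set \<Rightarrow> ('q \<Rightarrow> 'q \<Rightarrow> bool) \<Rightarrow> bool" where
  "poset_isomorphic P le Q le' \<longleftrightarrow>
     (\<exists>f. bij_betw f P Q \<and> (\<forall>x\<in>P. \<forall>y\<in>P. le x y \<longleftrightarrow> le' (f x) (f y)))"

end

theory Submission
  imports Defs
begin

text \<open>
  For a nonempty face \<open>F\<close> of \<open>C\<close>, the normal cone \<open>N\<^sub>F\<close> consists of the vectors of the polar cone
  of \<open>C\<close> that are orthogonal to \<open>F\<close>. The isomorphism matches the interval \<open>[F, H]\<close> of the face
  lattice with the cone \<open>F + N\<^sub>H\<close>, for which two things must be understood.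

  The cones \<open>F + N\<^sub>H\<close> with \<open>F \<subseteq> H\<close> are exactly the faces of the fan. Each face of a
  sum of two cones is the sum of a face of one and a face of the other, and this applies to
  \<open>G + N\<^sub>G\<close> (lemma \<open>face_moreau_cone_decompose\<close>). A nonempty face of \<open>G\<close> is a face \<open>F \<subseteq> G\<close> of \<open>C\<close>,
  and a nonempty face of \<open>N\<^sub>G\<close> is \<open>N\<^sub>H\<close> for a face \<open>H \<supseteq> G\<close> of \<open>C\<close> (lemma
  \<open>face_of_normal_cone_obtain\<close>); the latter rests on the finite generation of \<open>C\<close>. Conversely,
  \<open>N\<^sub>H\<close> is a face of \<open>N\<^sub>F\<close>, and therefore \<open>F + N\<^sub>H\<close> is a face of the orthogonal sum \<open>F + N\<^sub>F\<close>.

  The inclusion \<open>F + N\<^sub>H \<subseteq> F' + N\<^sub>H\<^sub>'\<close> holds iff \<open>F \<subseteq> F'\<close> and \<open>H' \<subseteq> H\<close>. Indeed a vector is the sum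
  of a point of \<open>C\<close> and an orthogonal point of the polar cone in at most one way (Moreau's
  decomposition, lemma \<open>moreau_decomposition_unique\<close>), so the inclusion can be tested on the two
  summands separately, and \<open>N\<^sub>H\<close> determines \<open>H\<close> because faces of polyhedra are exposed.

  In particular \<open>F + N\<^sub>H \<subseteq> G + N\<^sub>G\<close> iff \<open>F \<subseteq> G \<subseteq> H\<close>. Hence the isomorphism has a description that
  does not mention \<open>F\<close> and \<open>H\<close>: it sends a face \<open>T\<close> of the fan to the set of all \<open>G\<close> whose
  maximal cone \<open>G + N\<^sub>G\<close> contains \<open>T\<close>.
\<close>

section \<open>Faces of convex cones\<close>

text \<open>
  For cones, the segments in the definition of a face can be replaced by sums, because \<open>x + y\<close> is
  the midpoint of \<open>2x\<close> and \<open>2y\<close>, and a point is an inner point of the segment from 0 to its double.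
\<close>

lemma face_of_convex_cone_iff:
  fixes P :: "'a::real_vector set"
  assumes P: "convex_cone P"
  shows "F face_of P \<and> F \<noteq> {} \<longleftrightarrow>
    F \<subseteq> P \<and> convex_cone F \<and> (\<forall>x\<in>P. \<forall>y\<in>P. x + y \<in> F \<longrightarrow> x \<in> F \<and> y \<in> F)"
    (is "?L \<longleftrightarrow> ?R")
proof
  have P0: "0 \<in> P" and Pscale: "\<And>x c. x \<in> P \<Longrightarrow> c \<ge> 0 \<Longrightarrow> c *\<^sub>R x \<in> P"
    using P by (auto simp: convex_cone_iff)
  assume L: ?L
  then have sub: "F \<subseteq> P" and conv: "convex F" by (auto simp: face_of_def)
  have seg: "a \<in> F \<and> b \<in> F" if "a \<in> P" "b \<in> P" "x \<in> F" "x \<in> open_segment a b" for a b x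
    using L that by (meson face_ofD)
  have ray: "0 \<in> F \<and> c *\<^sub>R x \<in> F" if x: "x \<in> F" and c: "c > 1" for x and c :: real
  proof (cases "x = 0")
    case False
    have "x \<in> open_segment 0 (c *\<^sub>R x)"
      using False c by (auto simp: in_segment intro!: exI[of _ "1/c"])
    moreover have "c *\<^sub>R x \<in> P"
      using sub x c by (intro Pscale) auto
    ultimately show ?thesis
      using seg P0 x by blast
  qed (use x in auto)
  have F0: "0 \<in> F"
    using L ray[of _ 2] by auto
  have scale: "c *\<^sub>R x \<in> F" if "x \<in> F" "c \<ge> 0" for x c
  proof (cases "c > 1")
    case True
    with ray that show ?thesis by blast
  next
    case False
    then have "c *\<^sub>R x + (1 - c) *\<^sub>R 0 \<in> F"
      using conv that F0 by (intro convexD) auto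
    then show ?thesis by simp
  qed
  have add: "x + y \<in> F" if "x \<in> F" "y \<in> F" for x y
  proof -
    have "(1/2) *\<^sub>R x + (1/2) *\<^sub>R y \<in> F"
      using conv that by (intro convexD) auto
    then have "2 *\<^sub>R ((1/2) *\<^sub>R x + (1/2) *\<^sub>R y) \<in> F"
      using scale by simp
    then show ?thesis by (simp add: algebra_simps)
  qed
  have summand: "x \<in> F \<and> y \<in> F" if x: "x \<in> P" and y: "y \<in> P" and xy: "x + y \<in> F" for x y
  proof -
    have "2 *\<^sub>R x \<in> F \<and> 2 *\<^sub>R y \<in> F"
    proof (cases "x = y")
      case True
      then show ?thesis using xy by (simp add: scaleR_2)
    next
      case False
      then have "x + y \<in> open_segment (2 *\<^sub>R x) (2 *\<^sub>R y)"
        by (auto simp: in_segment intro!: exI[of _ "1/2"])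
      then show ?thesis
        using seg[of "2 *\<^sub>R x" "2 *\<^sub>R y" "x + y"] xy Pscale[of _ 2] x y by simp
    qed
    then show ?thesis
      using scale[of "2 *\<^sub>R x" "1/2"] scale[of "2 *\<^sub>R y" "1/2"] by simp
  qed
  have "convex_cone F"
    unfolding convex_cone_iff by (intro conjI ballI allI impI F0 add scale)
  then show ?R
    using sub summand by (intro conjI ballI impI) blast+
next
  assume R: ?R
  have Pscale: "\<And>x c. x \<in> P \<Longrightarrow> c \<ge> 0 \<Longrightarrow> c *\<^sub>R x \<in> P"
    using P by (auto simp: convex_cone_iff)
  have F: "F \<noteq> {}" "convex F" and Fscale: "\<And>x c. x \<in> F \<Longrightarrow> c \<ge> 0 \<Longrightarrow> c *\<^sub>R x \<in> F"
    using R by (auto simp: convex_cone_def conic_def)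
  have "a \<in> F \<and> b \<in> F"
    if ab: "a \<in> P" "b \<in> P" and x: "x \<in> F" "x \<in> open_segment a b" for a b x
  proof -
    obtain u where u: "0 < u" "u < 1" "x = (1 - u) *\<^sub>R a + u *\<^sub>R b"
      using x by (auto simp: in_segment)
    have "(1 - u) *\<^sub>R a \<in> F \<and> u *\<^sub>R b \<in> F"
      using R x u Pscale[of a "1 - u"] Pscale[of b u] ab by simp
    then show ?thesis
      using u Fscale[of "(1 - u) *\<^sub>R a" "inverse (1 - u)"] Fscale[of "u *\<^sub>R b" "inverse u"] by simp
  qed
  then show ?L
    using R F unfolding face_of_def by blast
qed

lemma face_lattice_convex_coneD:
  assumes "convex_cone P" and "F \<in> face_lattice P"
  shows "F \<subseteq> P" and "convex_cone F"
    and "\<And>x y. x \<in> P \<Longrightarrow> y \<in> P \<Longrightarrow> x + y \<in> F \<Longrightarrow> x \<in> F"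
    and "\<And>x y. x \<in> P \<Longrightarrow> y \<in> P \<Longrightarrow> x + y \<in> F \<Longrightarrow> y \<in> F"
  using assms face_of_convex_cone_iff[of P F] unfolding face_lattice_def by blast+

lemma face_lattice_convex_coneI:
  assumes "convex_cone P" "F \<subseteq> P" "convex_cone F"
    and "\<And>x y. x \<in> P \<Longrightarrow> y \<in> P \<Longrightarrow> x + y \<in> F \<Longrightarrow> x \<in> F \<and> y \<in> F"
  shows "F \<in> face_lattice P"
  using assms face_of_convex_cone_iff[of P F] unfolding face_lattice_def by blast

lemma convex_cone_plus:
  assumes "convex_cone A" "convex_cone B"
  shows "convex_cone (A + B)"
proof -
  have "A + B = (\<Union>x\<in>A. \<Union>y\<in>B. {x + y})"
    by (auto simp: set_plus_def)
  then show ?thesis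
    using convex_cone_sums[OF assms] by simp
qed

lemma zero_in_convex_cone: "convex_cone A \<Longrightarrow> 0 \<in> A"
  by (simp add: convex_cone_iff)

lemma polyhedral_cone_imp_convex_cone: "polyhedral_cone C \<Longrightarrow> convex_cone C"
  by (simp add: polyhedral_cone_def convex_cone_def polyhedron_imp_convex cone_def conic_def)

section \<open>Normal cones and Moreau's decomposition\<close>

text \<open>
  A linear functional that is bounded above on a cone has supremum 0, so the maximum over \<open>C\<close> that
  is attained on \<open>F\<close> can only be 0.
\<close>

lemma mem_normal_cone_iff:
  fixes C :: "'a::real_inner set"
  assumes C: "convex_cone C" and F: "F \<subseteq> C" "F \<noteq> {}"
  shows "c \<in> normal_cone F C \<longleftrightarrow> (\<forall>x\<in>C. c \<bullet> x \<le> 0) \<and> (\<forall>y\<in>F. c \<bullet> y = 0)"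
proof
  assume c: "c \<in> normal_cone F C"
  have "c \<bullet> y = 0" if y: "y \<in> F" for y
  proof -
    have "0 \<in> C" "2 *\<^sub>R y \<in> C"
      using C F y by (auto simp: convex_cone_iff)
    then have "c \<bullet> 0 \<le> c \<bullet> y" "c \<bullet> (2 *\<^sub>R y) \<le> c \<bullet> y"
      using c y unfolding normal_cone_def by blast+
    then show ?thesis by simp
  qed
  then show "(\<forall>x\<in>C. c \<bullet> x \<le> 0) \<and> (\<forall>y\<in>F. c \<bullet> y = 0)"
    using c F unfolding normal_cone_def by fastforce
qed (auto simp: normal_cone_def)

lemma mem_normal_cone_face_iff:
  fixes C :: "'a::real_inner set"
  assumes "convex_cone C" "F \<in> face_lattice C"
  shows "c \<in> normal_cone F C \<longleftrightarrow> (\<forall>x\<in>C. c \<bullet> x \<le> 0) \<and> (\<forall>y\<in>F. c \<bullet> y = 0)"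
  using assms by (intro mem_normal_cone_iff) (auto simp: face_lattice_def dest: face_of_imp_subset)

lemma normal_cone_antimono: "F \<subseteq> H \<Longrightarrow> normal_cone H C \<subseteq> normal_cone F C"
  by (auto simp: normal_cone_def)

lemma convex_cone_normal_cone:
  fixes C :: "'a::real_inner set"
  shows "convex_cone (normal_cone F C)"
  unfolding convex_cone_iff normal_cone_def
  by (auto simp: inner_add_left add_mono mult_left_mono)

text \<open>
  Expanding the square of the norm of \<open>y - y'\<close> as its inner product with \<open>c' - c\<close> leaves only the
  cross terms \<open>c \<bullet> y'\<close> and \<open>c' \<bullet> y\<close>, which are nonpositive by polarity.
\<close>

lemma moreau_decomposition_unique:
  fixes y c :: "'a::real_inner"
  assumes eq: "y + c = y' + c'"
    and y: "y \<in> C" "y' \<in> C"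
    and polar: "\<forall>x\<in>C. c \<bullet> x \<le> 0" "\<forall>x\<in>C. c' \<bullet> x \<le> 0"
    and orth: "c \<bullet> y = 0" "c' \<bullet> y' = 0"
  shows "y = y'" and "c = c'"
proof -
  have diff: "y - y' = c' - c"
    using eq by (simp add: algebra_simps)
  have "(y - y') \<bullet> (y - y') = (c' - c) \<bullet> (y - y')"
    using diff by simp
  also have "\<dots> = c' \<bullet> y + c \<bullet> y'"
    using orth by (simp add: inner_diff_left inner_diff_right)
  also have "\<dots> \<le> 0"
    using y polar by (simp add: add_nonpos_nonpos)
  finally show "y = y'"
    by (metis inner_gt_zero_iff not_le right_minus_eq)
  then show "c = c'"
    using eq by simp
qed

lemma face_plus_normal_cone_unique:
  fixes C :: "'a::real_inner set"
  assumes C: "convex_cone C"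
    and faces: "F \<in> face_lattice C" "F' \<in> face_lattice C"
    and yc: "y \<in> F" "c \<in> normal_cone F C"
    and yc': "y' \<in> F'" "c' \<in> normal_cone F' C"
    and eq: "y + c = y' + c'"
  shows "y = y'" and "c = c'"
proof -
  have "y \<in> C" "y' \<in> C" "\<forall>x\<in>C. c \<bullet> x \<le> 0" "\<forall>x\<in>C. c' \<bullet> x \<le> 0" "c \<bullet> y = 0" "c' \<bullet> y' = 0"
    using yc yc' face_lattice_convex_coneD(1)[OF C] faces
    by (auto simp: mem_normal_cone_face_iff[OF C])
  then show "y = y'" "c = c'"
    using moreau_decomposition_unique[OF eq] by blast+
qed

section \<open>Faces of normal cones\<close>

text \<open>
  A functional exposing \<open>H\<close> belongs to the normal cone of \<open>H\<close>; membership in that of \<open>H'\<close> says that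
  it vanishes on \<open>H'\<close> too.
\<close>

lemma normal_cone_subset_iff:
  fixes C :: "'a::euclidean_space set"
  assumes poly: "polyhedral_cone C"
    and H: "H \<in> face_lattice C" and H': "H' \<in> face_lattice C"
  shows "normal_cone H C \<subseteq> normal_cone H' C \<longleftrightarrow> H' \<subseteq> H"
proof
  note C = polyhedral_cone_imp_convex_cone[OF poly]
  assume sub: "normal_cone H C \<subseteq> normal_cone H' C"
  have "H exposed_face_of C"
    using poly H by (simp add: polyhedral_cone_def exposed_face_of_polyhedron face_lattice_def)
  then obtain a b where ab: "C \<subseteq> {x. a \<bullet> x \<le> b}" "H = C \<inter> {x. a \<bullet> x = b}"
    by (auto simp: exposed_face_of_def)
  have "0 \<in> H"
    using zero_in_convex_cone face_lattice_convex_coneD(2)[OF C H] by blast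
  then have "b = 0"
    using ab by simp
  then have "a \<in> normal_cone H C"
    unfolding mem_normal_cone_face_iff[OF C H] using ab by auto
  then have "\<forall>y\<in>H'. a \<bullet> y = 0"
    using sub mem_normal_cone_face_iff[OF C H'] by blast
  then show "H' \<subseteq> H"
    using ab \<open>b = 0\<close> face_lattice_convex_coneD(1)[OF C H'] by auto
qed (rule normal_cone_antimono)

text \<open>
  Two vectors of the polar cone take nonpositive values on \<open>H\<close>, so their sum can vanish on \<open>H\<close> only
  if both of them do.
\<close>

lemma normal_cone_in_face_lattice:
  fixes C :: "'a::real_inner set"
  assumes C: "convex_cone C"
    and F: "F \<in> face_lattice C" and H: "H \<in> face_lattice C" and "F \<subseteq> H"
  shows "normal_cone H C \<in> face_lattice (normal_cone F C)"
proof (rule face_lattice_convex_coneI)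
  fix a b
  assume ab: "a \<in> normal_cone F C" "b \<in> normal_cone F C" "a + b \<in> normal_cone H C"
  have le: "\<forall>x\<in>C. a \<bullet> x \<le> 0" "\<forall>x\<in>C. b \<bullet> x \<le> 0"
    using ab by (auto simp: mem_normal_cone_face_iff[OF C F])
  have "a \<bullet> y = 0 \<and> b \<bullet> y = 0" if "y \<in> H" for y
  proof -
    have "a \<bullet> y + b \<bullet> y = 0"
      using ab(3) that by (simp add: mem_normal_cone_face_iff[OF C H] inner_add_left)
    moreover have "a \<bullet> y \<le> 0" "b \<bullet> y \<le> 0"
      using le that face_lattice_convex_coneD(1)[OF C H] by auto
    ultimately show ?thesis by linarith
  qed
  then show "a \<in> normal_cone H C \<and> b \<in> normal_cone H C"
    using le by (simp add: mem_normal_cone_face_iff[OF C H])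
qed (use \<open>F \<subseteq> H\<close> in \<open>auto simp: convex_cone_normal_cone dest: normal_cone_antimono\<close>)

text \<open>
  The cube of side 2 cuts out of \<open>C\<close> a polytope, and every point of \<open>C\<close> can be scaled down into
  the cube; so finitely many points whose convex hull is that polytope generate \<open>C\<close>. What is needed of
  them is that they decide membership in the polar cone.
\<close>

lemma polyhedral_cone_generators:
  fixes C :: "'a::euclidean_space set"
  assumes poly: "polyhedral_cone C"
  obtains V where "finite V" "V \<subseteq> C"
    "\<And>c. \<forall>v\<in>V. c \<bullet> v \<le> 0 \<Longrightarrow> \<forall>x\<in>C. c \<bullet> x \<le> 0"
proof -
  let ?Q = "C \<inter> cbox (- One) One"
  have "polytope ?Q"
    using poly by (intro polyhedron_Int_polytope polytope_interval) (simp add: polyhedral_cone_def)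
  then obtain V where V: "finite V" "?Q = convex hull V"
    by (auto simp: polytope_def)
  have "c \<bullet> x \<le> 0" if c: "\<forall>v\<in>V. c \<bullet> v \<le> 0" and x: "x \<in> C" for c x
  proof -
    have "convex hull V \<subseteq> {z. c \<bullet> z \<le> 0}"
      using c by (intro hull_minimal) (auto simp: convex_halfspace_le)
    then have Q: "c \<bullet> z \<le> 0" if "z \<in> ?Q" for z
      using that V by blast
    define r where "r = inverse (norm x + 1)"
    have r: "r > 0" "r * norm x \<le> 1"
      unfolding r_def by (auto simp: divide_simps add_pos_nonneg add_nonneg_pos)
    have "\<bar>(r *\<^sub>R x) \<bullet> i\<bar> \<le> 1" if "i \<in> Basis" for i
      using Basis_le_norm[OF that, of "r *\<^sub>R x"] r by simp
    then have "r *\<^sub>R x \<in> cbox (- One) One"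
      by (auto simp: mem_box abs_le_iff minus_le_iff)
    moreover have "r *\<^sub>R x \<in> C"
      using poly x r by (auto simp: polyhedral_cone_def cone_def)
    ultimately have "c \<bullet> (r *\<^sub>R x) \<le> 0"
      using Q by blast
    then show ?thesis
      using r by (simp add: mult_le_0_iff)
  qed
  moreover have "V \<subseteq> C"
    using V hull_subset[of V convex] by blast
  ultimately show thesis
    using that V by blast
qed

text \<open>
  Let \<open>k\<close> be a relative interior point of \<open>K\<close> and let \<open>H\<close> be the face of \<open>C\<close> on which \<open>k\<close> vanishes.
  Every vector of \<open>K\<close> vanishes on \<open>H\<close>, since \<open>k\<close> can be moved a little away from it inside \<open>K\<close>.
  Conversely, for \<open>n\<close> in the normal cone of \<open>H\<close> and small \<open>\<epsilon> > 0\<close>, the vector \<open>k - \<epsilon> n\<close> is still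
  in the polar cone: it suffices to check finitely many generators of \<open>C\<close>, and on those outside
  \<open>H\<close> the functional \<open>k\<close> is strictly negative. As \<open>k\<close> is the sum of \<open>k - \<epsilon> n\<close> and \<open>\<epsilon> n\<close>, both
  summands lie in the face \<open>K\<close>.
\<close>

lemma face_of_normal_cone_obtain:
  fixes C :: "'a::euclidean_space set"
  assumes poly: "polyhedral_cone C" and G: "G \<in> face_lattice C"
    and K: "K \<in> face_lattice (normal_cone G C)"
  obtains H where "H \<in> face_lattice C" "G \<subseteq> H" "K = normal_cone H C"
proof -
  note C = polyhedral_cone_imp_convex_cone[OF poly]
  note NG = convex_cone_normal_cone[of G C]
  note mem_G = mem_normal_cone_face_iff[OF C G]
  note K_face = face_lattice_convex_coneD[OF NG K]
  have Kconv: "convex K" "K \<noteq> {}"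
    using K_face(2) by (auto simp: convex_cone_def)
  obtain k where k: "k \<in> rel_interior K"
    using rel_interior_eq_empty[OF Kconv(1)] Kconv(2) by blast
  then have kK: "k \<in> K"
    using rel_interior_subset by blast
  then have k_polar: "\<forall>x\<in>C. k \<bullet> x \<le> 0" and k_G: "\<forall>y\<in>G. k \<bullet> y = 0"
    using K_face(1) mem_G by blast+
  define H where "H = C \<inter> {x. k \<bullet> x = 0}"
  have GH: "G \<subseteq> H"
    using k_G face_lattice_convex_coneD(1)[OF C G] by (auto simp: H_def)
  have "H face_of C"
    unfolding H_def using C k_polar
    by (intro face_of_Int_supporting_hyperplane_le) (auto simp: convex_cone_def)
  then have H: "H \<in> face_lattice C"
    using GH G by (auto simp: face_lattice_def)
  note mem_H = mem_normal_cone_face_iff[OF C H]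
  have "c \<in> normal_cone H C" if c: "c \<in> K" for c
  proof -
    obtain e where e: "e > 1" "(1 - e) *\<^sub>R c + e *\<^sub>R k \<in> K"
      using k c convex_rel_interior_iff[OF Kconv] by blast
    have c_polar: "\<forall>x\<in>C. c \<bullet> x \<le> 0"
      using K_face(1) mem_G c by blast
    have "c \<bullet> x = 0" if x: "x \<in> H" for x
    proof -
      have "((1 - e) *\<^sub>R c + e *\<^sub>R k) \<bullet> x \<le> 0"
        using e(2) K_face(1) mem_G x by (auto simp: H_def)
      then have "(1 - e) * (c \<bullet> x) \<le> 0"
        using x by (simp add: inner_add_left H_def)
      then have "c \<bullet> x \<ge> 0"
        using e(1) by (simp add: mult_le_0_iff)
      then show ?thesis
        using c_polar x by (force simp: H_def)
    qed
    then show ?thesis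
      using c_polar by (simp add: mem_H)
  qed
  moreover have "n \<in> K" if n: "n \<in> normal_cone H C" for n
  proof -
    obtain V where V: "finite V" "V \<subseteq> C"
      "\<And>c. \<forall>v\<in>V. c \<bullet> v \<le> 0 \<Longrightarrow> \<forall>x\<in>C. c \<bullet> x \<le> 0"
      using polyhedral_cone_generators[OF poly] by blast
    have "\<forall>\<^sub>F e in at_right 0. (k - e *\<^sub>R n) \<bullet> v \<le> 0" if v: "v \<in> V" for v
    proof (cases "v \<in> H")
      case True
      then have "k \<bullet> v = 0" "n \<bullet> v = 0"
        using n mem_H by (auto simp: H_def)
      then show ?thesis
        by (simp add: inner_diff_left)
    next
      case False
      then have neg: "k \<bullet> v < 0"
        using v V(2) k_polar by (force simp: H_def)
      have "((\<lambda>e. (k - e *\<^sub>R n) \<bullet> v) \<longlongrightarrow> (k - 0 *\<^sub>R n) \<bullet> v) (at_right 0)"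
        by (intro tendsto_intros)
      then have "\<forall>\<^sub>F e in at_right 0. (k - e *\<^sub>R n) \<bullet> v < 0"
        using neg by (intro order_tendstoD) auto
      then show ?thesis
        by (rule eventually_mono) simp
    qed
    then have "\<forall>\<^sub>F e in at_right 0. e > 0 \<and> (\<forall>v\<in>V. (k - e *\<^sub>R n) \<bullet> v \<le> 0)"
      using V(1) by (auto simp: eventually_ball_finite_distrib eventually_at_right_less
          intro!: eventually_conj)
    then obtain e :: real where e: "e > 0" "\<forall>v\<in>V. (k - e *\<^sub>R n) \<bullet> v \<le> 0"
      using eventually_happens[of _ "at_right (0::real)"] by auto
    have "\<forall>y\<in>G. n \<bullet> y = 0"
      using n GH by (auto simp: mem_H)
    then have "k - e *\<^sub>R n \<in> normal_cone G C"
      using V(3)[OF e(2)] k_G by (simp add: mem_G inner_diff_left)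
    moreover have "e *\<^sub>R n \<in> normal_cone G C"
      using subsetD[OF normal_cone_antimono[OF GH] n] e(1) NG by (auto simp: convex_cone_iff)
    moreover have "(k - e *\<^sub>R n) + e *\<^sub>R n \<in> K"
      using kK by simp
    ultimately have "e *\<^sub>R n \<in> K"
      using K_face(4) by blast
    then have "inverse e *\<^sub>R (e *\<^sub>R n) \<in> K"
      using K_face(2) e(1) unfolding convex_cone_iff by (meson inverse_nonnegative_iff_nonnegative less_imp_le)
    then show ?thesis
      using e(1) by simp
  qed
  ultimately have "K = normal_cone H C"
    by blast
  with H GH show thesis
    by (rule that)
qed

section \<open>Faces of the Moreau fan\<close>

text \<open>
  A face of a sum of two cones is closed under passing to summands, so it is the sum of its
  intersections with the two cones.
\<close>

lemma face_moreau_cone_decompose: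
  fixes C :: "'a::euclidean_space set"
  assumes poly: "polyhedral_cone C" and G: "G \<in> face_lattice C"
    and T: "T \<in> face_lattice (moreau_cone G C)"
  obtains F H where "F \<in> face_lattice C" "H \<in> face_lattice C" "F \<subseteq> H"
    "T = F + normal_cone H C"
proof -
  note C = polyhedral_cone_imp_convex_cone[OF poly]
  let ?N = "normal_cone G C"
  have coneG: "convex_cone G"
    using face_lattice_convex_coneD(2)[OF C G] .
  have coneN: "convex_cone ?N"
    by (rule convex_cone_normal_cone)
  have coneP: "convex_cone (moreau_cone G C)"
    unfolding moreau_cone_def using coneG coneN by (rule convex_cone_plus)
  note T_face = face_lattice_convex_coneD[OF coneP T]
  have T0: "0 \<in> T" and T_add: "\<And>x y. x \<in> T \<Longrightarrow> y \<in> T \<Longrightarrow> x + y \<in> T"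
    using T_face(2) by (auto simp: convex_cone_iff)
  have GP: "G \<subseteq> moreau_cone G C" and NP: "?N \<subseteq> moreau_cone G C"
    unfolding moreau_cone_def
    using set_zero_plus2[OF zero_in_convex_cone[OF coneN], of G]
      set_zero_plus2[OF zero_in_convex_cone[OF coneG], of ?N] by (auto simp: add.commute)
  have slice: "T \<inter> S \<in> face_lattice S" if S: "S \<subseteq> moreau_cone G C" "convex_cone S" for S
    using T T0 S face_of_slice[of T "moreau_cone G C" S] zero_in_convex_cone[OF S(2)]
    by (auto simp: face_lattice_def convex_cone_def Int_absorb1)
  have "T \<inter> G \<in> face_lattice C"
    using slice[OF GP coneG] G by (auto simp: face_lattice_def intro: face_of_trans)
  moreover obtain H where H: "H \<in> face_lattice C" "G \<subseteq> H" "T \<inter> ?N = normal_cone H C"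
    using face_of_normal_cone_obtain[OF poly G slice[OF NP coneN]] .
  moreover have "T = (T \<inter> G) + (T \<inter> ?N)"
  proof
    show "T \<subseteq> (T \<inter> G) + (T \<inter> ?N)"
    proof
      fix t assume t: "t \<in> T"
      then have "t \<in> G + ?N"
        using T_face(1) by (auto simp: moreau_cone_def)
      then obtain y c where yc: "t = y + c" "y \<in> G" "c \<in> ?N"
        by (rule set_plus_elim)
      moreover have "y \<in> T" "c \<in> T"
        using T_face(3)[of y c] T_face(4)[of y c] t yc GP NP by auto
      ultimately show "t \<in> (T \<inter> G) + (T \<inter> ?N)"
        by auto
    qed
    show "(T \<inter> G) + (T \<inter> ?N) \<subseteq> T"
      using T_add by (auto elim!: set_plus_elim)
  qed
  ultimately show thesis
    using that[of "T \<inter> G" H] by auto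
qed

text \<open>
  By uniqueness of Moreau's decomposition, if a sum of two points of \<open>F + N\<^sub>F\<close> lies in \<open>F + N\<^sub>H\<close>, then
  the sum of their components in \<open>N\<^sub>F\<close> lies in \<open>N\<^sub>H\<close>, which is a face of \<open>N\<^sub>F\<close>.
\<close>

lemma face_plus_normal_cone_in_face_lattice:
  fixes C :: "'a::real_inner set"
  assumes C: "convex_cone C"
    and F: "F \<in> face_lattice C" and H: "H \<in> face_lattice C" and FH: "F \<subseteq> H"
  shows "F + normal_cone H C \<in> face_lattice (moreau_cone F C)"
proof (rule face_lattice_convex_coneI)
  have coneF: "convex_cone F"
    using face_lattice_convex_coneD(2)[OF C F] .
  show "convex_cone (moreau_cone F C)" "convex_cone (F + normal_cone H C)"
    unfolding moreau_cone_def by (intro convex_cone_plus coneF convex_cone_normal_cone)+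
  show "F + normal_cone H C \<subseteq> moreau_cone F C"
    unfolding moreau_cone_def by (intro set_plus_mono2 normal_cone_antimono FH order_refl)
  fix u v
  assume "u \<in> moreau_cone F C" "v \<in> moreau_cone F C" and uv: "u + v \<in> F + normal_cone H C"
  then obtain y1 c1 y2 c2
    where u: "u = y1 + c1" "y1 \<in> F" "c1 \<in> normal_cone F C"
      and v: "v = y2 + c2" "y2 \<in> F" "c2 \<in> normal_cone F C"
    unfolding moreau_cone_def by (meson set_plus_elim)
  obtain y c where yc: "u + v = y + c" "y \<in> F" "c \<in> normal_cone H C"
    using uv by (rule set_plus_elim)
  have eq: "(y1 + y2) + (c1 + c2) = y + c"
    using yc(1) u(1) v(1) by (simp add: algebra_simps)
  have "y1 + y2 \<in> F" "c1 + c2 \<in> normal_cone F C"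
    using coneF convex_cone_normal_cone[of F C] u v by (auto simp: convex_cone_iff)
  moreover have "c \<in> normal_cone F C"
    using yc(3) normal_cone_antimono[OF FH] by blast
  ultimately have "c1 + c2 = c"
    using face_plus_normal_cone_unique(2)[OF C F F _ _ yc(2) _ eq] by blast
  then have "c1 \<in> normal_cone H C" "c2 \<in> normal_cone H C"
    using face_lattice_convex_coneD(3,4)[OF convex_cone_normal_cone
        normal_cone_in_face_lattice[OF C F H FH] u(3) v(3)] yc(3) by auto
  then show "u \<in> F + normal_cone H C \<and> v \<in> F + normal_cone H C"
    using u v by auto
qed

lemma fan_face_lattice_moreau_fan:
  fixes C :: "'a::euclidean_space set"
  assumes poly: "polyhedral_cone C"
  shows "fan_face_lattice (moreau_fan C) =
    {F + normal_cone H C | F H. F \<in> face_lattice C \<and> H \<in> face_lattice C \<and> F \<subseteq> H}"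
    (is "?L = ?R")
proof
  show "?L \<subseteq> ?R"
  proof
    fix T assume "T \<in> ?L"
    then obtain G where "G \<in> face_lattice C" "T \<in> face_lattice (moreau_cone G C)"
      unfolding fan_face_lattice_def moreau_fan_def by blast
    then obtain F H where "F \<in> face_lattice C" "H \<in> face_lattice C" "F \<subseteq> H"
        "T = F + normal_cone H C"
      by (rule face_moreau_cone_decompose[OF poly])
    then show "T \<in> ?R" by blast
  qed
  show "?R \<subseteq> ?L"
    using face_plus_normal_cone_in_face_lattice[OF polyhedral_cone_imp_convex_cone[OF poly]]
    unfolding fan_face_lattice_def moreau_fan_def by blast
qed

text \<open>
  Both summands contain 0, so \<open>F\<close> and the normal cone of \<open>H\<close> are contained in the sum, and uniqueness
  of the decomposition puts them into the corresponding summands of the larger cone.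
\<close>

lemma face_plus_normal_cone_subset_iff:
  fixes C :: "'a::euclidean_space set"
  assumes poly: "polyhedral_cone C"
    and F: "F \<in> face_lattice C" and H: "H \<in> face_lattice C" and FH: "F \<subseteq> H"
    and F': "F' \<in> face_lattice C" and H': "H' \<in> face_lattice C" and FH': "F' \<subseteq> H'"
  shows "F + normal_cone H C \<subseteq> F' + normal_cone H' C \<longleftrightarrow> F \<subseteq> F' \<and> H' \<subseteq> H"
    (is "?S \<subseteq> ?S' \<longleftrightarrow> _")
proof
  note C = polyhedral_cone_imp_convex_cone[OF poly]
  assume sub: "?S \<subseteq> ?S'"
  have key: "y \<in> F' \<and> c \<in> normal_cone H' C" if y: "y \<in> F" and c: "c \<in> normal_cone H C" for y c
  proof -
    have "y + c \<in> ?S'"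
      using sub y c by auto
    then obtain y' c' where yc': "y + c = y' + c'" "y' \<in> F'" "c' \<in> normal_cone H' C"
      by (rule set_plus_elim)
    moreover have "c \<in> normal_cone F C" "c' \<in> normal_cone F' C"
      using c yc' normal_cone_antimono[OF FH] normal_cone_antimono[OF FH'] by auto
    ultimately have "y = y'" "c = c'"
      using face_plus_normal_cone_unique[OF C F F' y] by blast+
    then show ?thesis
      using yc' by simp
  qed
  have "0 \<in> F" "0 \<in> normal_cone H C"
    by (auto intro!: zero_in_convex_cone convex_cone_normal_cone face_lattice_convex_coneD(2)[OF C F])
  then have "F \<subseteq> F'" "normal_cone H C \<subseteq> normal_cone H' C"
    using key by blast+
  then show "F \<subseteq> F' \<and> H' \<subseteq> H"
    using normal_cone_subset_iff[OF poly H H'] by blast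
next
  assume "F \<subseteq> F' \<and> H' \<subseteq> H"
  then show "?S \<subseteq> ?S'"
    by (intro set_plus_mono2 normal_cone_antimono) auto
qed

section \<open>The isomorphism\<close>

text \<open>
  The maximal cone of \<open>G\<close> is itself the cone of the interval \<open>[G, G]\<close>, so comparing it with the
  cone of \<open>[F, H]\<close> recovers the interval.
\<close>

lemma moreau_cones_containing_face:
  fixes C :: "'a::euclidean_space set"
  assumes "polyhedral_cone C" "F \<in> face_lattice C" "H \<in> face_lattice C" "F \<subseteq> H"
  shows "{G \<in> face_lattice C. F + normal_cone H C \<subseteq> moreau_cone G C} =
    interval (face_lattice C) (\<subseteq>) F H"
  unfolding interval_def moreau_cone_def
proof (intro Collect_cong conj_cong refl)
  fix G assume "G \<in> face_lattice C"
  then show "F + normal_cone H C \<subseteq> G + normal_cone G C \<longleftrightarrow> F \<subseteq> G \<and> G \<subseteq> H"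
    by (intro face_plus_normal_cone_subset_iff[OF assms] order_refl)
qed

lemma interval_subset_iff:
  fixes P :: "'a set set"
  assumes "a \<in> P" "c \<in> P" "a \<subseteq> c"
  shows "interval P (\<subseteq>) a c \<subseteq> interval P (\<subseteq>) a' c' \<longleftrightarrow> a' \<subseteq> a \<and> c \<subseteq> c'"
proof
  assume sub: "interval P (\<subseteq>) a c \<subseteq> interval P (\<subseteq>) a' c'"
  have "a \<in> interval P (\<subseteq>) a c" "c \<in> interval P (\<subseteq>) a c"
    using assms by (simp_all add: interval_def)
  then have "a \<in> interval P (\<subseteq>) a' c'" "c \<in> interval P (\<subseteq>) a' c'"
    using sub by (meson subsetD)+
  then show "a' \<subseteq> a \<and> c \<subseteq> c'"
    by (simp add: interval_def)
next
  assume "a' \<subseteq> a \<and> c \<subseteq> c'"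
  then show "interval P (\<subseteq>) a c \<subseteq> interval P (\<subseteq>) a' c'"
    by (auto simp only: interval_def mem_Collect_eq intro: order_trans)
qed

theorem proposition3p1:
  fixes C :: "'a::euclidean_space set"
  assumes "polyhedral_cone C"
  shows "poset_isomorphic (fan_face_lattice (moreau_fan C)) (\<subseteq>)
           (interval_poset (face_lattice C) (\<subseteq>)) (\<supseteq>)"
proof -
  let ?L = "face_lattice C"
  let ?f = "\<lambda>T. {G \<in> ?L. T \<subseteq> moreau_cone G C}"
  note faces = fan_face_lattice_moreau_fan[OF assms]
  note f_eq = moreau_cones_containing_face[OF assms]
  have order: "T \<subseteq> T' \<longleftrightarrow> ?f T \<supseteq> ?f T'"
    if T: "T \<in> fan_face_lattice (moreau_fan C)" and T': "T' \<in> fan_face_lattice (moreau_fan C)"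
    for T T'
  proof -
    obtain F H where FH: "F \<in> ?L" "H \<in> ?L" "F \<subseteq> H" and T: "T = F + normal_cone H C"
      using T unfolding faces by blast
    obtain F' H' where FH': "F' \<in> ?L" "H' \<in> ?L" "F' \<subseteq> H'" and T': "T' = F' + normal_cone H' C"
      using T' unfolding faces by blast
    show ?thesis
      unfolding T T' f_eq[OF FH] f_eq[OF FH'] interval_subset_iff[OF FH']
      by (rule face_plus_normal_cone_subset_iff[OF assms FH FH'])
  qed
  have "inj_on ?f (fan_face_lattice (moreau_fan C))"
    using order by (intro inj_onI) blast
  moreover have "?f ` fan_face_lattice (moreau_fan C) = interval_poset ?L (\<subseteq>)"
  proof
    show "?f ` fan_face_lattice (moreau_fan C) \<subseteq> interval_poset ?L (\<subseteq>)"
    proof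
      fix I assume "I \<in> ?f ` fan_face_lattice (moreau_fan C)"
      then obtain F H where FH: "F \<in> ?L" "H \<in> ?L" "F \<subseteq> H" and I: "I = ?f (F + normal_cone H C)"
        unfolding faces by blast
      have "F \<in> interval ?L (\<subseteq>) F H"
        using FH by (simp add: interval_def)
      then show "I \<in> interval_poset ?L (\<subseteq>)"
        using I f_eq[OF FH] FH unfolding interval_poset_def by blast
    qed
    show "interval_poset ?L (\<subseteq>) \<subseteq> ?f ` fan_face_lattice (moreau_fan C)"
    proof
      fix I assume "I \<in> interval_poset ?L (\<subseteq>)"
      then obtain F H where "F \<in> ?L" "H \<in> ?L" "I = interval ?L (\<subseteq>) F H" "I \<noteq> {}"
        unfolding interval_poset_def by blast
      moreover from this have "F \<subseteq> H"
        unfolding interval_def by blast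
      ultimately have "I = ?f (F + normal_cone H C)"
          "F + normal_cone H C \<in> fan_face_lattice (moreau_fan C)"
        unfolding faces using f_eq by auto
      then show "I \<in> ?f ` fan_face_lattice (moreau_fan C)"
        by blast
    qed
  qed
  ultimately have "bij_betw ?f (fan_face_lattice (moreau_fan C)) (interval_poset ?L (\<subseteq>))"
    by (simp add: bij_betw_def)
  then show ?thesis
    unfolding poset_isomorphic_def using order by blast
qed

end
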